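(* For all closed terms $P,Q$ over $\Sigma_{SCL}(A)$, $\mathrm{EqMSCL}\vdash P=Q$ if and only if $\mathit{mse}(P)=\mathit{mse}(Q)$.
   Context: $A$ is a non-empty set of atoms; closed terms over $\Sigma_{SCL}(A)$: $P::=a\mid\mathsf T\mid\mathsf F\mid\neg P\mid P\land_s P\mid P\lor_s P$ ($a\in A$), with $\land_s,\lor_s$ sequential (short-circuit) conjunction and disjunction. $\mathrm{EqMSCL}$ consists of (Neg) $\mathsf F=\neg\mathsf T$, (Or) $x\lor_s y=\neg(\neg x\land_s\neg y)$, (Tand) $\mathsf T\land_s x=x$, (Abs) $x\land_s(x\lor_s y)=x$, (Mem) $(x\lor_s y)\land_s z=(\neg x\land_s(y\land_s z))\lor_s(x\land_s z)$; $\vdash$ is equational-logic derivability. Evaluation trees $\mathcal T_A$: generated by $\mathsf T,\mathsf F$ and $X\unlhd a\unrhd Y$ ($a\in A$; root $a$, left branch $X$, right branch $Y$). Leaf replacement $X[\mathsf T\mapsto Y,\mathsf F\mapsto Z]$ replaces $\mathsf T$-leaves by $Y$ and $\mathsf F$-leaves by $Z$. $se(\mathsf T)=\mathsf T$, $se(\mathsf F)=\mathsf F$, $se(a)=\mathsf T\unlhd a\unrhd\mathsf F$, $se(\neg P)=se(P)[\mathsf T\mapsto\mathsf F,\mathsf F\mapsto\mathsf T]$, $se(P\land_s Q)=se(P)[\mathsf T\mapsto se(Q)]$, $se(P\lor_s Q)=se(P)[\mathsf F\mapsto se(Q)]$. $\mathit{mse}(P)=m(se(P))$ where $m(\mathsf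 T)=\mathsf T$, $m(\mathsf F)=\mathsf F$, $m(X\unlhd a\unrhd Y)=m(L_a(X))\unlhd a\unrhd m(R_a(Y))$; $L_a,R_a$ fix $\mathsf T,\mathsf F$, $L_a(X\unlhd b\unrhd Y)=L_a(X)$ if $b=a$ and $L_a(X)\unlhd b\unrhd L_a(Y)$ otherwise, $R_a(X\unlhd b\unrhd Y)=R_a(Y)$ if $b=a$ and $R_a(X)\unlhd b\unrhd R_a(Y)$ otherwise. *)

theory Defs
  imports Main
begin

text \<open>The set of atoms is the type \<open>'a\<close>, which is arbitrary (and, as every HOL type, non-empty).\<close>

datatype 'a cterm =
    Atom 'a
  | Tru
  | Fls
  | Neg "'a cterm"
  | And "'a cterm" "'a cterm"
  | Or "'a cterm" "'a cterm"

text \<open>Terms over the same signature, with variables from a countably infinite supply.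
  Equational derivations between closed terms may pass through terms with variables.\<close>

datatype 'a oterm =
    OVar nat
  | OAtom 'a
  | OTru
  | OFls
  | ONeg "'a oterm"
  | OAnd "'a oterm" "'a oterm"
  | OOr "'a oterm" "'a oterm"

primrec open_term :: "'a cterm \<Rightarrow> 'a oterm" where
  "open_term (Atom a) = OAtom a"
| "open_term Tru = OTru"
| "open_term Fls = OFls"
| "open_term (Neg P) = ONeg (open_term P)"
| "open_term (And P Q) = OAnd (open_term P) (open_term Q)"
| "open_term (Or P Q) = OOr (open_term P) (open_term Q)"

primrec subst :: "(nat \<Rightarrow> 'a oterm) \<Rightarrow> 'a oterm \<Rightarrow> 'a oterm" where
  "subst \<sigma> (OVar i) = \<sigma> i"
| "subst \<sigma> (OAtom a) = OAtom a"
| "subst \<sigma> OTru = OTru"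
| "subst \<sigma> OFls = OFls"
| "subst \<sigma> (ONeg s) = ONeg (subst \<sigma> s)"
| "subst \<sigma> (OAnd s t) = OAnd (subst \<sigma> s) (subst \<sigma> t)"
| "subst \<sigma> (OOr s t) = OOr (subst \<sigma> s) (subst \<sigma> t)"

inductive derivable :: "('a oterm \<times> 'a oterm) set \<Rightarrow> 'a oterm \<Rightarrow> 'a oterm \<Rightarrow> bool"
  for E where
  ax: "(s, t) \<in> E \<Longrightarrow> derivable E s t"
| refl: "derivable E s s"
| sym: "derivable E s t \<Longrightarrow> derivable E t s"
| trans: "derivable E s t \<Longrightarrow> derivable E t u \<Longrightarrow> derivable E s u"
| subst: "derivable E s t \<Longrightarrow> derivable E (subst \<sigma> s) (subst \<sigma> t)"
| cong_neg: "derivable E s t \<Longrightarrow> derivable E (ONeg s) (ONeg t)"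
| cong_and: "derivable E s t \<Longrightarrow> derivable E s' t' \<Longrightarrow> derivable E (OAnd s s') (OAnd t t')"
| cong_or: "derivable E s t \<Longrightarrow> derivable E s' t' \<Longrightarrow> derivable E (OOr s s') (OOr t t')"

text \<open>The axioms (Neg), (Or), (Tand), (Abs), (Mem), in this order.\<close>

definition EqMSCL :: "('a oterm \<times> 'a oterm) set" where
  "EqMSCL = (let x = OVar 0; y = OVar 1; z = OVar 2 in
    {(OFls, ONeg OTru),
     (OOr x y, ONeg (OAnd (ONeg x) (ONeg y))),
     (OAnd OTru x, x),
     (OAnd x (OOr x y), x),
     (OAnd (OOr x y) z, OOr (OAnd (ONeg x) (OAnd y z)) (OAnd x z))})"

text \<open>\<open>Node X a Y\<close> has root \<open>a\<close>, left branch \<open>X\<close> (taken when \<open>a\<close> evaluates to true) and right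
  branch \<open>Y\<close>.\<close>

datatype 'a etree = LeafT | LeafF | Node "'a etree" 'a "'a etree"

text \<open>\<open>leaf_repl X Y Z\<close> is $X[\mathsf{T} \mapsto Y, \mathsf{F} \mapsto Z]$.\<close>

primrec leaf_repl :: "'a etree \<Rightarrow> 'a etree \<Rightarrow> 'a etree \<Rightarrow> 'a etree" where
  "leaf_repl LeafT Y Z = Y"
| "leaf_repl LeafF Y Z = Z"
| "leaf_repl (Node X1 a X2) Y Z = Node (leaf_repl X1 Y Z) a (leaf_repl X2 Y Z)"

primrec se :: "'a cterm \<Rightarrow> 'a etree" where
  "se Tru = LeafT"
| "se Fls = LeafF"
| "se (Atom a) = Node LeafT a LeafF"
| "se (Neg P) = leaf_repl (se P) LeafF LeafT"
| "se (And P Q) = leaf_repl (se P) (se Q) LeafF"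
| "se (Or P Q) = leaf_repl (se P) LeafT (se Q)"

primrec left_red :: "'a \<Rightarrow> 'a etree \<Rightarrow> 'a etree" where
  "left_red a LeafT = LeafT"
| "left_red a LeafF = LeafF"
| "left_red a (Node X b Y) =
    (if b = a then left_red a X else Node (left_red a X) b (left_red a Y))"

primrec right_red :: "'a \<Rightarrow> 'a etree \<Rightarrow> 'a etree" where
  "right_red a LeafT = LeafT"
| "right_red a LeafF = LeafF"
| "right_red a (Node X b Y) =
    (if b = a then right_red a Y else Node (right_red a X) b (right_red a Y))"

lemma size_left_red: "size (left_red a X) \<le> size X"
  by (induction X) auto

lemma size_right_red: "size (right_red a X) \<le> size X"
  by (induction X) auto

function memo :: "'a etree \<Rightarrow> 'a etree" where
  "memo LeafT = LeafT"
| "memo LeafF = LeafF"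
| "memo (Node X a Y) = Node (memo (left_red a X)) a (memo (right_red a Y))"
  by pat_completeness auto
termination
  by (relation "measure size")
    (auto simp: less_Suc_eq_le intro: order_trans[OF size_left_red] order_trans[OF size_right_red])

definition mse :: "'a cterm \<Rightarrow> 'a etree" where
  "mse P = memo (se P)"

end

theory Submission imports Defs begin

text \<open>Soundness: for every valuation, the pair of the truth value and of the list of distinct atoms in
  order of first evaluation is an element of a model of EqMSCL, in which terms denote the traces of
  their evaluation trees. The reduction \<open>memo\<close> does not change traces, and a memorizing tree is
  determined by its traces under all valuations.

  Completeness: in every model of EqMSCL the conditional \<open>(x \<and> y) \<or> (\<not> x \<and> z)\<close> satisfies
  the laws of composition of trees and of memorization. Reading a tree as a nested conditional,
  each closed term is therefore equal to its evaluation tree and to the memorizing form of that tree.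
  Applied to the term model, this yields derivability. The equational work consists in deriving
  associativity and the laws of the conditional from the five axioms; it is halved by the observation
  that the axioms imply their De Morgan duals.\<close>

section \<open>Models of EqMSCL\<close>

locale mscl =
  fixes tt :: 'b ("\<^bold>T") and ff :: 'b ("\<^bold>F")
    and neg :: "'b \<Rightarrow> 'b" ("\<^bold>\<not> _" [80] 80)
    and conj :: "'b \<Rightarrow> 'b \<Rightarrow> 'b" (infixr "\<^bold>\<and>" 75)
    and disj :: "'b \<Rightarrow> 'b \<Rightarrow> 'b" (infixr "\<^bold>\<or>" 70)
  assumes ff_eq: "\<^bold>F = \<^bold>\<not> \<^bold>T"
    and disj_eq: "x \<^bold>\<or> y = \<^bold>\<not> (\<^bold>\<not> x \<^bold>\<and> \<^bold>\<not> y)"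
    and tt_conj: "\<^bold>T \<^bold>\<and> x = x"
    and absorb: "x \<^bold>\<and> (x \<^bold>\<or> y) = x"
    and mem: "(x \<^bold>\<or> y) \<^bold>\<and> z = (\<^bold>\<not> x \<^bold>\<and> y \<^bold>\<and> z) \<^bold>\<or> (x \<^bold>\<and> z)"
begin

lemma tt_disj: "\<^bold>T \<^bold>\<or> x = \<^bold>T"
  by (metis tt_conj absorb)

text \<open>(Mem) with T for \<open>x\<close> writes every element as a disjunction, hence as a
  negation. So F \<and> w has negation T for every w, and the same instance then reads z = \<not>
  \<not> z.\<close>

lemma neg_neg: "\<^bold>\<not> \<^bold>\<not> x = x"
  by (metis ff_eq disj_eq tt_conj absorb mem)

lemma neg_conj: "\<^bold>\<not> (x \<^bold>\<and> y) = \<^bold>\<not> x \<^bold>\<or> \<^bold>\<not> y"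
  by (simp add: disj_eq neg_neg)

lemma neg_disj: "\<^bold>\<not> (x \<^bold>\<or> y) = \<^bold>\<not> x \<^bold>\<and> \<^bold>\<not> y"
  by (simp add: disj_eq neg_neg)

lemma neg_ff: "\<^bold>\<not> \<^bold>F = \<^bold>T"
  by (simp add: ff_eq neg_neg)

lemma disj_conj_absorb: "x \<^bold>\<or> (x \<^bold>\<and> y) = x"
  by (metis absorb neg_conj neg_disj neg_neg)

lemma disj_mem: "(x \<^bold>\<and> y) \<^bold>\<or> z = (\<^bold>\<not> x \<^bold>\<or> y \<^bold>\<or> z) \<^bold>\<and> (x \<^bold>\<or> z)"
  by (metis mem neg_conj neg_disj neg_neg)

end

text \<open>Swapping the constants and the connectives gives a model again, so each law comes with
  its dual under the prefix \<open>dual\<close>.\<close>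

sublocale mscl \<subseteq> dual: mscl ff tt neg disj conj
proof
  show "tt = neg ff"
    by (simp add: neg_ff)
  show "conj x y = neg (disj (neg x) (neg y))" for x y
    by (simp add: neg_disj neg_neg)
  show "disj ff x = x" for x
    by (metis tt_conj ff_eq disj_eq neg_neg)
qed (fact disj_conj_absorb disj_mem)+


section \<open>Laws of memorization: constants, ignored outcomes, repeated arguments\<close>

lemma (in mscl) disj_ff: "x \<^bold>\<or> \<^bold>F = x"
  using mem[of "\<^bold>F" "\<^bold>T" x] by (simp add: dual.tt_conj neg_ff tt_conj dual.tt_disj)

lemma (in mscl) conj_idem: "x \<^bold>\<and> x = x"
  by (metis absorb disj_ff)

lemma (in mscl) disj_alt: "x \<^bold>\<or> y = (\<^bold>\<not> x \<^bold>\<and> y) \<^bold>\<or> x"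
  by (metis mem dual.disj_ff)

lemma (in mscl) disj_tt: "x \<^bold>\<or> \<^bold>T = x \<^bold>\<or> \<^bold>\<not> x"
  by (metis disj_alt dual.disj_ff conj_idem)

text \<open>The outcome of \<open>x\<close> is ignored, so it may be inverted: both sides equal
  \<not> x \<or> x.\<close>

lemma (in mscl) disj_tt_neg: "\<^bold>\<not> x \<^bold>\<or> \<^bold>T = x \<^bold>\<or> \<^bold>T"
  by (metis disj_alt disj_tt dual.disj_ff neg_neg)

lemma (in mscl) ff_disj_conj: "(x \<^bold>\<and> \<^bold>F) \<^bold>\<or> (x \<^bold>\<and> y) = x \<^bold>\<and> y"
  using mem[of x "\<^bold>F" y] by (simp add: disj_ff dual.tt_disj dual.disj_tt_neg)

lemma (in mscl) conj_left_idem: "x \<^bold>\<and> x \<^bold>\<and> y = x \<^bold>\<and> y"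
  by (metis dual.mem[of x "\<^bold>F" "x \<^bold>\<and> y"] disj_conj_absorb dual.disj_alt dual.tt_conj ff_disj_conj)

lemma (in mscl) neg_conj_conj: "\<^bold>\<not> x \<^bold>\<and> x \<^bold>\<and> y = x \<^bold>\<and> \<^bold>F"
  by (metis dual.disj_alt dual.absorb dual.disj_tt dual.disj_tt_neg neg_neg)

lemma (in mscl) conj_neg_disj: "x \<^bold>\<and> (\<^bold>\<not> x \<^bold>\<or> y) = x \<^bold>\<and> y"
  by (metis dual.disj_alt dual.conj_left_idem)

lemma (in mscl) conj_ff_ff: "(x \<^bold>\<and> \<^bold>F) \<^bold>\<and> \<^bold>F = x \<^bold>\<and> \<^bold>F"
  by (metis neg_conj mem dual.disj_tt_neg neg_neg ff_disj_conj dual.tt_disj)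

lemma (in mscl) conj_ff_conj: "(x \<^bold>\<and> \<^bold>F) \<^bold>\<and> y = x \<^bold>\<and> \<^bold>F"
  by (metis conj_ff_ff ff_disj_conj disj_conj_absorb)

lemma (in mscl) disj_conj_self: "(x \<^bold>\<or> y) \<^bold>\<and> x = x \<^bold>\<or> (y \<^bold>\<and> x)"
  by (metis mem disj_alt conj_idem)

lemma (in mscl) conj_conj_left: "(x \<^bold>\<and> y) \<^bold>\<and> x = x \<^bold>\<and> y"
  by (metis neg_neg neg_disj absorb dual.absorb disj_alt dual.disj_alt dual.conj_neg_disj
      dual.disj_conj_self)

lemma (in mscl) conj_disj_ff: "(x \<^bold>\<and> y) \<^bold>\<or> (x \<^bold>\<and> \<^bold>F) = x \<^bold>\<and> y"
  by (metis ff_disj_conj dual.conj_conj_left)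

lemma (in mscl) conj_conj_same: "x \<^bold>\<and> y \<^bold>\<and> x = x \<^bold>\<and> y"
  by (metis dual.disj_alt mem neg_neg dual.disj_tt dual.disj_tt_neg conj_disj_ff)

text \<open>Prefixing x \<and> z with a disjunct equal to x \<and> F changes nothing. The dual of
  (Mem) then applies, and (Mem) read backwards creates the factor x \<or> y.\<close>

lemma (in mscl) conj_disj_conj: "x \<^bold>\<and> (x \<^bold>\<or> y) \<^bold>\<and> z = x \<^bold>\<and> z"
proof -
  have "x \<^bold>\<and> z = (x \<^bold>\<and> \<^bold>\<not> x \<^bold>\<and> y \<^bold>\<and> z) \<^bold>\<or> (x \<^bold>\<and> z)"
    using neg_conj_conj[of "\<^bold>\<not> x" "y \<^bold>\<and> z"] by (simp add: neg_neg dual.disj_tt_neg ff_disj_conj)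
  also have "\<dots> = (\<^bold>\<not> x \<^bold>\<or> (x \<^bold>\<or> y) \<^bold>\<and> z) \<^bold>\<and> x"
    by (simp add: dual.mem mem[of x y z] disj_conj_absorb)
  also have "\<dots> = x \<^bold>\<and> (x \<^bold>\<or> y) \<^bold>\<and> z"
    by (simp flip: dual.disj_alt)
  finally show ?thesis
    by simp
qed

lemma (in mscl) conj_conj_disj: "x \<^bold>\<and> y \<^bold>\<and> (x \<^bold>\<or> z) = x \<^bold>\<and> y"
  by (metis conj_conj_same conj_disj_conj)

lemma (in mscl) conj_disj_conj_left: "x \<^bold>\<and> ((x \<^bold>\<and> y) \<^bold>\<or> z) = x \<^bold>\<and> (y \<^bold>\<or> z)"
  by (metis conj_neg_disj dual.mem conj_conj_disj)

text \<open>The conditional ``if \<open>x\<close> then \<open>y\<close> else \<open>z\<close>''. In the second disjunct \<open>x\<close> is evaluated again; this is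
  harmless because its value is memorized.\<close>

definition (in mscl) ite :: "'b \<Rightarrow> 'b \<Rightarrow> 'b \<Rightarrow> 'b" where
  "ite x y z = (x \<^bold>\<and> y) \<^bold>\<or> (\<^bold>\<not> x \<^bold>\<and> z)"

text \<open>This and the next lemma carry the memory of \<open>x\<close>; they later justify
  \<open>left_red\<close> and \<open>right_red\<close>.\<close>

lemma (in mscl) conj_ite: "x \<^bold>\<and> ite x y z = x \<^bold>\<and> y"
  by (metis ite_def conj_disj_conj_left conj_neg_disj dual.conj_conj_disj)

lemma (in mscl) neg_conj_ite: "\<^bold>\<not> x \<^bold>\<and> ite x y z = \<^bold>\<not> x \<^bold>\<and> z"
  by (metis ite_def conj_neg_disj dual.conj_disj_conj conj_left_idem neg_neg)

lemma (in mscl) ite_same: "ite x y y = (x \<^bold>\<or> \<^bold>T) \<^bold>\<and> y"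
  using mem[of "\<^bold>\<not> x" "\<^bold>T" y] by (simp add: ite_def tt_conj disj_tt_neg neg_neg)

text \<open>\<open>ite x s s\<close> is \<open>s\<close> preceded by an evaluation of \<open>x\<close> whose outcome is ignored, so it is
  symmetric in \<open>x\<close> and \<open>\<^bold>\<not> x\<close>; both sides below equal it for \<open>s = ite x y z\<close>.\<close>

lemma (in mscl) ite_neg: "ite (\<^bold>\<not> x) z y = ite x y z"
proof -
  let ?s = "ite x y z"
  have "ite (\<^bold>\<not> x) z y = ite (\<^bold>\<not> x) ?s ?s"
    by (simp add: ite_def[of "\<^bold>\<not> x"] neg_neg conj_ite neg_conj_ite)
  also have "\<dots> = ite x ?s ?s"
    by (simp add: ite_same disj_tt_neg)
  also have "\<dots> = ite x y z"
    by (simp add: ite_def[of x ?s] conj_ite neg_conj_ite) (simp add: ite_def)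
  finally show ?thesis .
qed

section \<open>Associativity of conjunction\<close>

text \<open>By (Mem), (\<not> x \<or> y) \<and> z is the conditional
  \<open>ite x (y \<and> z) z\<close>, whose first branch is selected by \<open>x\<close>.\<close>

lemma (in mscl) conj_neg_disj_conj: "x \<^bold>\<and> (\<^bold>\<not> x \<^bold>\<or> y) \<^bold>\<and> z = x \<^bold>\<and> y \<^bold>\<and> z"
  using mem[of "\<^bold>\<not> x" y z] conj_ite[of x "y \<^bold>\<and> z" z] by (simp add: neg_neg ite_def)

lemma (in mscl) conj_conj_conj_left: "x \<^bold>\<and> (x \<^bold>\<and> y) \<^bold>\<and> z = x \<^bold>\<and> y \<^bold>\<and> z"
  by (metis conj_neg_disj_conj dual.conj_neg_disj neg_neg)

lemma (in mscl) conj_assoc: "(x \<^bold>\<and> y) \<^bold>\<and> z = x \<^bold>\<and> y \<^bold>\<and> z"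
proof -
  \<comment> \<open>Write the first factor as a disjunction by \<open>ff_disj_conj\<close> and apply (Mem): this yields that \<open>?a\<close> already
    starts with \<open>x\<close>.\<close>
  let ?a = "(x \<^bold>\<and> y) \<^bold>\<and> z"
  have "\<^bold>\<not> x \<^bold>\<and> ?a = x \<^bold>\<and> \<^bold>F"
    by (metis conj_conj_conj_left conj_conj_same neg_conj_conj)
  then have "(x \<^bold>\<or> \<^bold>T) \<^bold>\<and> ?a = x \<^bold>\<and> ?a"
    by (simp add: conj_disj_ff ite_def flip: ite_same)
  moreover have "\<^bold>\<not> (x \<^bold>\<and> \<^bold>F) = x \<^bold>\<or> \<^bold>T"
    by (simp add: neg_conj neg_ff disj_tt_neg)
  ultimately have "((x \<^bold>\<and> \<^bold>F) \<^bold>\<or> (x \<^bold>\<and> y)) \<^bold>\<and> z = x \<^bold>\<and> ?a"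
    by (simp add: mem conj_ff_conj conj_disj_ff)
  then show ?thesis
    by (simp add: ff_disj_conj conj_conj_conj_left)
qed

section \<open>The conditional commutes with the connectives\<close>

lemma (in mscl) ite_eq_conj: "ite x y z = (\<^bold>\<not> x \<^bold>\<or> y) \<^bold>\<and> (x \<^bold>\<or> z)"
  unfolding ite_def dual.mem by (metis dual.conj_conj_disj dual.conj_neg_disj)

lemma (in mscl) neg_ite: "\<^bold>\<not> ite x y z = ite x (\<^bold>\<not> y) (\<^bold>\<not> z)"
  by (simp add: ite_eq_conj[of x "\<^bold>\<not> y"]) (simp add: ite_def neg_conj neg_disj neg_neg)

text \<open>By \<open>conj_conj_same\<close>, \<open>x\<close> may be evaluated again after
  \<open>y\<close>, so an equation valid under \<open>x\<close> survives the evaluation of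
  \<open>y\<close>.\<close>

lemma (in mscl) conj_conj_cong:
  assumes "x \<^bold>\<and> z = x \<^bold>\<and> w"
  shows "x \<^bold>\<and> y \<^bold>\<and> z = x \<^bold>\<and> y \<^bold>\<and> w"
  using assms by (metis conj_assoc conj_conj_same)

text \<open>(Mem) is applied to the conjunctive form of the conditional. Both branches then contain
  x \<or> z, which the known value of \<open>x\<close> simplifies.\<close>

lemma (in mscl) ite_conj: "ite x y z \<^bold>\<and> u = ite x (y \<^bold>\<and> u) (z \<^bold>\<and> u)"
proof -
  have "x \<^bold>\<and> y \<^bold>\<and> (x \<^bold>\<or> z) \<^bold>\<and> u = x \<^bold>\<and> y \<^bold>\<and> u"
    by (metis conj_assoc conj_conj_disj)
  moreover have "\<^bold>\<not> x \<^bold>\<and> (x \<^bold>\<or> z) \<^bold>\<and> u = \<^bold>\<not> x \<^bold>\<and> z \<^bold>\<and> u"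
    using conj_neg_disj_conj[of "\<^bold>\<not> x" z u] by (simp add: neg_neg)
  ultimately show ?thesis
    using mem[of "\<^bold>\<not> x" y "(x \<^bold>\<or> z) \<^bold>\<and> u"]
    by (simp add: ite_eq_conj[of x y z] conj_assoc neg_neg) (simp add: ite_def)
qed

lemma (in mscl) ite_conj_ite: "ite x y z \<^bold>\<and> ite x u v = ite x (y \<^bold>\<and> u) (z \<^bold>\<and> v)"
  unfolding ite_conj ite_def[of x "_ \<^bold>\<and> _"]
  by (simp add: conj_conj_cong[OF conj_ite] conj_conj_cong[OF neg_conj_ite])

lemma (in mscl) ite_disj_ite: "ite x y z \<^bold>\<or> ite x u v = ite x (y \<^bold>\<or> u) (z \<^bold>\<or> v)"
  by (simp add: disj_eq[of "ite x y z"] neg_ite ite_conj_ite) (simp add: neg_conj neg_neg)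

text \<open>Negation, conjunction and disjunction act branchwise on conditionals over
  \<open>x\<close>. This is the node case of \<open>tree_eval_leaf_repl\<close>.\<close>

lemma (in mscl) ite_ite: "ite (ite x y z) u v = ite x (ite y u v) (ite z u v)"
  by (simp add: ite_def[of "ite x y z"] ite_def[of y] ite_def[of z] neg_ite ite_conj ite_disj_ite)

lemma (in mscl) ite_tt: "ite \<^bold>T y z = y"
  by (simp add: ite_def tt_conj disj_ff dual.tt_disj flip: ff_eq)

lemma (in mscl) ite_ff: "ite \<^bold>F y z = z"
  using ite_neg[of "\<^bold>T" y z] by (simp add: ite_tt flip: ff_eq)

lemma (in mscl) ite_tt_right: "ite x \<^bold>T y = x \<^bold>\<or> y"
  by (simp add: ite_def dual.disj_ff dual.conj_neg_disj)

lemma (in mscl) ite_ff_left: "ite x \<^bold>F y = \<^bold>\<not> x \<^bold>\<and> y"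
  using ff_disj_conj[of "\<^bold>\<not> x" y] by (simp add: ite_def dual.disj_tt_neg)

lemma (in mscl) ite_ff_right: "ite x y \<^bold>F = x \<^bold>\<and> y"
  using ite_ff_left[of "\<^bold>\<not> x" y] by (simp add: ite_neg neg_neg)

lemma (in mscl) conj_disj_distrib: "x \<^bold>\<and> (y \<^bold>\<or> z) = (x \<^bold>\<and> y) \<^bold>\<or> (x \<^bold>\<and> z)"
  using ite_disj_ite[of x y "\<^bold>F" z "\<^bold>F"] by (simp add: ite_ff_right disj_ff)

lemma (in mscl) conj_ite_cong:
  assumes "x \<^bold>\<and> u = x \<^bold>\<and> u'" and "x \<^bold>\<and> v = x \<^bold>\<and> v'"
  shows "x \<^bold>\<and> ite y u v = x \<^bold>\<and> ite y u' v'"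
  using conj_conj_cong[OF assms(1)] conj_conj_cong[OF assms(2)]
  by (simp add: ite_def conj_disj_distrib)

section \<open>Evaluation trees in a model\<close>

primrec (in mscl) tree_eval :: "('a \<Rightarrow> 'b) \<Rightarrow> 'a etree \<Rightarrow> 'b" where
  "tree_eval \<alpha> LeafT = \<^bold>T"
| "tree_eval \<alpha> LeafF = \<^bold>F"
| "tree_eval \<alpha> (Node X a Y) = ite (\<alpha> a) (tree_eval \<alpha> X) (tree_eval \<alpha> Y)"

primrec (in mscl) term_eval :: "('a \<Rightarrow> 'b) \<Rightarrow> (nat \<Rightarrow> 'b) \<Rightarrow> 'a oterm \<Rightarrow> 'b" where
  "term_eval \<alpha> \<rho> (OVar i) = \<rho> i"
| "term_eval \<alpha> \<rho> (OAtom a) = \<alpha> a"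
| "term_eval \<alpha> \<rho> OTru = \<^bold>T"
| "term_eval \<alpha> \<rho> OFls = \<^bold>F"
| "term_eval \<alpha> \<rho> (ONeg s) = \<^bold>\<not> term_eval \<alpha> \<rho> s"
| "term_eval \<alpha> \<rho> (OAnd s t) = term_eval \<alpha> \<rho> s \<^bold>\<and> term_eval \<alpha> \<rho> t"
| "term_eval \<alpha> \<rho> (OOr s t) = term_eval \<alpha> \<rho> s \<^bold>\<or> term_eval \<alpha> \<rho> t"

lemma (in mscl) tree_eval_leaf_repl:
  "tree_eval \<alpha> (leaf_repl X Y Z) = ite (tree_eval \<alpha> X) (tree_eval \<alpha> Y) (tree_eval \<alpha> Z)"
  by (induction X) (simp_all add: ite_tt ite_ff ite_ite)

lemma (in mscl) term_eval_open_term: "term_eval \<alpha> \<rho> (open_term P) = tree_eval \<alpha> (se P)"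
  by (induction P)
    (simp_all add: tree_eval_leaf_repl ite_ff_left ite_ff_right ite_tt_right dual.disj_ff disj_ff)

lemma (in mscl) conj_tree_eval_left_red:
  "\<alpha> a \<^bold>\<and> tree_eval \<alpha> (left_red a X) = \<alpha> a \<^bold>\<and> tree_eval \<alpha> X"
  by (induction X) (auto simp: conj_ite intro: conj_ite_cong)

lemma (in mscl) neg_conj_tree_eval_right_red:
  "\<^bold>\<not> \<alpha> a \<^bold>\<and> tree_eval \<alpha> (right_red a X) = \<^bold>\<not> \<alpha> a \<^bold>\<and> tree_eval \<alpha> X"
  by (induction X) (auto simp: neg_conj_ite intro: conj_ite_cong)

lemma (in mscl) tree_eval_memo: "tree_eval \<alpha> (memo X) = tree_eval \<alpha> X"
  by (induction X rule: memo.induct)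
    (simp_all add: ite_def conj_tree_eval_left_red neg_conj_tree_eval_right_red)

lemma (in mscl) term_eval_mse: "term_eval \<alpha> \<rho> (open_term P) = tree_eval \<alpha> (mse P)"
  by (simp add: mse_def tree_eval_memo term_eval_open_term)

lemma (in mscl) term_eval_subst:
  "term_eval \<alpha> \<rho> (subst \<sigma> s) = term_eval \<alpha> (\<lambda>i. term_eval \<alpha> \<rho> (\<sigma> i)) s"
  by (induction s) simp_all

lemma (in mscl) term_eval_derivable:
  "derivable EqMSCL s t \<Longrightarrow> term_eval \<alpha> \<rho> s = term_eval \<alpha> \<rho> t"
\<comment> \<open>The substitution rule changes the values of the variables, so
  \<open>\<rho>\<close> must be general.\<close>
proof (induction arbitrary: \<rho> rule: derivable.induct)
  case (ax s t)
  then consider "s = OFls" "t = ONeg OTru"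
    | "s = OOr (OVar 0) (OVar 1)" "t = ONeg (OAnd (ONeg (OVar 0)) (ONeg (OVar 1)))"
    | "s = OAnd OTru (OVar 0)" "t = OVar 0"
    | "s = OAnd (OVar 0) (OOr (OVar 0) (OVar 1))" "t = OVar 0"
    | "s = OAnd (OOr (OVar 0) (OVar 1)) (OVar 2)"
      "t = OOr (OAnd (ONeg (OVar 0)) (OAnd (OVar 1) (OVar 2))) (OAnd (OVar 0) (OVar 2))"
    by (auto simp: EqMSCL_def Let_def)
  then show ?case
    by cases (simp_all only: term_eval.simps ff_eq[symmetric] disj_eq[symmetric] tt_conj absorb mem)
qed (simp_all add: term_eval_subst)

section \<open>Soundness: the model of traces\<close>

text \<open>An element \<open>(b, l)\<close> records the outcome \<open>b\<close> of an evaluation and the distinct atoms \<open>l\<close> in the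
  order in which they were first evaluated.\<close>

definition trace_append :: "'a list \<Rightarrow> 'a list \<Rightarrow> 'a list" where
  "trace_append l m = l @ filter (\<lambda>x. x \<notin> set l) m"

definition trace_neg :: "bool \<times> 'a list \<Rightarrow> bool \<times> 'a list" where
  "trace_neg p = (\<not> fst p, snd p)"

definition trace_conj :: "bool \<times> 'a list \<Rightarrow> bool \<times> 'a list \<Rightarrow> bool \<times> 'a list" where
  "trace_conj p q = (if fst p then (fst q, trace_append (snd p) (snd q)) else p)"

definition trace_disj :: "bool \<times> 'a list \<Rightarrow> bool \<times> 'a list \<Rightarrow> bool \<times> 'a list" where
  "trace_disj p q = (if fst p then p else (fst q, trace_append (snd p) (snd q)))"

lemma trace_append_assoc:
  "trace_append (trace_append l m) n = trace_append l (trace_append m n)"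
  by (auto simp: trace_append_def intro!: filter_cong)

lemma trace_append_same: "trace_append l (trace_append m l) = trace_append l m"
  by (auto simp: trace_append_def filter_empty_conv)

lemma trace_append_Nil [simp]: "trace_append [] l = l" "trace_append l [] = l"
  by (simp_all add: trace_append_def)

lemma trace_append_idem: "trace_append l l = l"
  using trace_append_same[of l "[]"] by simp

lemma trace_append_left_idem: "trace_append l (trace_append l m) = trace_append l m"
  by (simp add: trace_append_idem flip: trace_append_assoc)

lemma trace_append_same2:
  "trace_append l (trace_append m (trace_append n l)) = trace_append l (trace_append m n)"
  using trace_append_same[of l "trace_append m n"] by (simp add: trace_append_assoc)

text \<open>The right side of (Mem) may evaluate \<open>x\<close> twice, with \<open>y\<close> and
  \<open>z\<close> in between; the band laws erase the repetition.\<close>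

interpretation trace: mscl "(True, [])" "(False, [])" trace_neg trace_conj trace_disj
proof
  show "trace_conj (trace_disj x y) z =
      trace_disj (trace_conj (trace_neg x) (trace_conj y z)) (trace_conj x z)"
    for x y z :: "bool \<times> 'a list"
    by (auto simp: trace_neg_def trace_conj_def trace_disj_def trace_append_assoc
        trace_append_same trace_append_same2 trace_append_idem trace_append_left_idem)
qed (auto simp: trace_neg_def trace_conj_def trace_disj_def trace_append_idem)

abbreviation tree_trace :: "('a \<Rightarrow> bool) \<Rightarrow> 'a etree \<Rightarrow> bool \<times> 'a list" where
  "tree_trace v \<equiv> trace.tree_eval (\<lambda>a. (v a, [a]))"

text \<open>Recursion along the single branch chosen by \<open>v\<close>; it replaces the defining
  equation, which is removed from the simp set below.\<close>

lemma tree_trace_Node: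
  "tree_trace v (Node X a Y) =
    (let p = tree_trace v (if v a then X else Y) in (fst p, a # filter (\<lambda>b. b \<noteq> a) (snd p)))"
  by (auto simp: trace.ite_def trace_neg_def trace_conj_def trace_disj_def trace_append_def
      filter_empty_conv Let_def)

lemma tree_trace_left_red:
  "tree_trace v (left_red a X) =
    map_prod id (filter (\<lambda>b. b \<noteq> a)) (tree_trace (v(a := True)) X)"
  by (induction X) (auto simp: tree_trace_Node Let_def map_prod_def case_prod_beta conj_commute
      simp del: trace.tree_eval.simps(3))

lemma tree_trace_right_red:
  "tree_trace v (right_red a X) =
    map_prod id (filter (\<lambda>b. b \<noteq> a)) (tree_trace (v(a := False)) X)"
  by (induction X) (auto simp: tree_trace_Node Let_def map_prod_def case_prod_beta conj_commute
      simp del: trace.tree_eval.simps(3))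

text \<open>A leaf has an empty trace and a node's trace starts with its root, so the roots agree;
  the reduced branches again have equal traces.\<close>

lemma memo_eqI:
  assumes "\<And>v. tree_trace v X = tree_trace v Y"
  shows "memo X = memo Y"
  using assms
proof (induction X arbitrary: Y rule: memo.induct)
  case 1
  then show ?case
    by (cases Y) (auto simp: tree_trace_Node Let_def simp del: trace.tree_eval.simps(3))
next
  case 2
  then show ?case
    by (cases Y) (auto simp: tree_trace_Node Let_def simp del: trace.tree_eval.simps(3))
next
  case (3 X1 a X2)
  obtain Y1 Y2 where Y: "Y = Node Y1 a Y2"
    using "3.prems"
    by (cases Y) (auto simp: tree_trace_Node Let_def simp del: trace.tree_eval.simps(3))
  have "tree_trace v (left_red a X1) = tree_trace v (left_red a Y1)" for v
    \<comment> \<open>Traces of trees reduced by \<open>left_red a\<close> do not depend on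
      \<open>v a\<close>, so choosing True, which selects the left branches, loses nothing.\<close>
    using "3.prems"[of "v(a := True)"]
    by (simp add: Y tree_trace_Node Let_def tree_trace_left_red map_prod_def case_prod_beta
        del: trace.tree_eval.simps(3))
  moreover have "tree_trace v (right_red a X2) = tree_trace v (right_red a Y2)" for v
    using "3.prems"[of "v(a := False)"]
    by (simp add: Y tree_trace_Node Let_def tree_trace_right_red map_prod_def case_prod_beta
        del: trace.tree_eval.simps(3))
  ultimately show ?case
    using "3.IH" by (simp add: Y)
qed

section \<open>Completeness: the term model\<close>

quotient_type 'a scl = "'a oterm" / "derivable EqMSCL"
  by (intro equivpI reflpI sympI transpI) (blast intro: derivable.refl derivable.sym derivable.trans)+

lift_definition scl_tt :: "'a scl" is OTru .
lift_definition scl_ff :: "'a scl" is OFls .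
lift_definition scl_neg :: "'a scl \<Rightarrow> 'a scl" is ONeg by (rule derivable.cong_neg)
lift_definition scl_conj :: "'a scl \<Rightarrow> 'a scl \<Rightarrow> 'a scl" is OAnd by (rule derivable.cong_and)
lift_definition scl_disj :: "'a scl \<Rightarrow> 'a scl \<Rightarrow> 'a scl" is OOr by (rule derivable.cong_or)

lemma derivable_axiom_instance:
  "(s, t) \<in> EqMSCL \<Longrightarrow> derivable EqMSCL (subst \<sigma> s) (subst \<sigma> t)"
  by (intro derivable.subst derivable.ax)

interpretation scl: mscl scl_tt scl_ff scl_neg scl_conj scl_disj
proof
  \<comment> \<open>Instantiates the axiom variables 0, 1, 2; axioms with fewer variables get
    \<open>x\<close> as a filler.\<close>
  let ?\<sigma> = "\<lambda>x y z i. if i = (0::nat) then x else if i = 1 then y else (z :: 'a oterm)"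
  show "(scl_ff :: 'a scl) = scl_neg scl_tt"
    by transfer (auto intro: derivable.ax simp: EqMSCL_def Let_def)
  show "scl_disj x y = scl_neg (scl_conj (scl_neg x) (scl_neg y))" for x y :: "'a scl"
  proof (transfer)
    show "derivable EqMSCL (OOr x y) (ONeg (OAnd (ONeg x) (ONeg y)))" for x y :: "'a oterm"
      using derivable_axiom_instance[of "OOr (OVar 0) (OVar 1)" _ "?\<sigma> x y x"]
      by (simp add: EqMSCL_def Let_def)
  qed
  show "scl_conj scl_tt x = x" for x :: "'a scl"
  proof (transfer)
    show "derivable EqMSCL (OAnd OTru x) x" for x :: "'a oterm"
      using derivable_axiom_instance[of "OAnd OTru (OVar 0)" _ "?\<sigma> x x x"]
      by (simp add: EqMSCL_def Let_def)
  qed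
  show "scl_conj x (scl_disj x y) = x" for x y :: "'a scl"
  proof (transfer)
    show "derivable EqMSCL (OAnd x (OOr x y)) x" for x y :: "'a oterm"
      using derivable_axiom_instance[of "OAnd (OVar 0) (OOr (OVar 0) (OVar 1))" _ "?\<sigma> x y x"]
      by (simp add: EqMSCL_def Let_def)
  qed
  show "scl_conj (scl_disj x y) z = scl_disj (scl_conj (scl_neg x) (scl_conj y z)) (scl_conj x z)"
    for x y z :: "'a scl"
  proof (transfer)
    show "derivable EqMSCL (OAnd (OOr x y) z) (OOr (OAnd (ONeg x) (OAnd y z)) (OAnd x z))"
      for x y z :: "'a oterm"
      using derivable_axiom_instance[of "OAnd (OOr (OVar 0) (OVar 1)) (OVar 2)" _ "?\<sigma> x y z"]
      by (simp add: EqMSCL_def Let_def)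
  qed
qed

text \<open>Under the canonical valuation each term denotes its own class, so equality of values is
  derivability.\<close>

lemma abs_scl_eq_term_eval:
  "abs_scl s = scl.term_eval (\<lambda>a. abs_scl (OAtom a)) (\<lambda>i. abs_scl (OVar i)) s"
  by (induction s)
    (simp_all flip: scl_tt_def scl_ff_def scl_neg.abs_eq scl_conj.abs_eq scl_disj.abs_eq)

theorem theorem5p9:
  fixes P Q :: "'a cterm"
  shows "derivable EqMSCL (open_term P) (open_term Q) \<longleftrightarrow> mse P = mse Q"
proof
  assume "derivable EqMSCL (open_term P) (open_term Q)"
  \<comment> \<open>Closed terms contain no variables, so the value \<open>(True, [])\<close> given
    to them is arbitrary.\<close>
  then have "tree_trace v (se P) = tree_trace v (se Q)" for v
    by (auto dest: trace.term_eval_derivable[where \<alpha> = "\<lambda>a. (v a, [a])" and \<rho> = "\<lambda>_. (True, [])"]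
        simp: trace.term_eval_open_term)
  then show "mse P = mse Q"
    unfolding mse_def by (rule memo_eqI)
next
  assume "mse P = mse Q"
  then have "abs_scl (open_term P) = abs_scl (open_term Q)"
    by (simp add: abs_scl_eq_term_eval[of "open_term _"] scl.term_eval_mse)
  then show "derivable EqMSCL (open_term P) (open_term Q)"
    by (simp add: scl.abs_eq_iff)
qed

end
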